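(* For every public bads instance $(N,A,c)$, every lottery returned by the Flipped-MNW rule is in the completion core.
   Context: A public bads instance $(N,A,c)$ consists of agents $N=\{1,\dots,n\}$, a finite set $A$ of alternatives (bads), and cost functions $c_i:A\to\mathbb{R}_{\ge 0}$, $i\in N$. $\Delta(A)$ is the set of lotteries (probability vectors) on $A$; $c_i(x)=\sum_{a\in A}x(a)c_i(a)$ and $c(x)=(c_i(x))_{i\in N}$. Standing assumptions: $0\notin\{c(x):x\in\Delta(A)\}$, and for every $i\in N$ there is $a\in A$ with $c_i(a)<\max_{a'\in A}c_i(a')$. Flipped-MNW: define dual valuations $v_i(a)=\max_{a'\in A}c_i(a')-c_i(a)$ for $i\in N$, $a\in A$, extended linearly to $v_i(x)=\sum_{a\in A}x(a)v_i(a)$. Flipped-MNW returns the set of all lotteries in $\arg\max_{x\in\Delta(A)}\prod_{i\in N}v_i(x)$. Completion core: $x\in\Delta(A)$ is in the completion core if there exist no $S\subseteq N$ and $y\in\Delta(A)$ such that $\frac{|S|}{n}c_i(y)+\frac{n-|S|}{n}\max_{a\in A}c_i(a)\le c_i(x)$ for every $i\in S$, with at least one of these inequalities strict. *)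

theory Defs
  imports Complex_Main
begin

text \<open>
  The agents are the natural numbers in \<open>{1..n}\<close>, the bads form a finite set \<open>A\<close>, and
  \<open>c i a\<close> is the cost of bad \<open>a\<close> to agent \<open>i\<close>. Costs matter only for \<open>i \<in> {1..n}\<close> and \<open>a \<in> A\<close>.
\<close>

text \<open>Lotteries vanish outside \<open>A\<close>, so that each probability vector on \<open>A\<close> has exactly one
  representative.\<close>

definition lotteries :: "'a set \<Rightarrow> ('a \<Rightarrow> real) set" where
  "lotteries A = {x. (\<forall>a\<in>A. 0 \<le> x a) \<and> (\<forall>a. a \<notin> A \<longrightarrow> x a = 0) \<and> (\<Sum>a\<in>A. x a) = 1}"

definition lin_ext :: "'a set \<Rightarrow> ('a \<Rightarrow> real) \<Rightarrow> ('a \<Rightarrow> real) \<Rightarrow> real" where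
  "lin_ext A f x = (\<Sum>a\<in>A. x a * f a)"

definition max_cost :: "'a set \<Rightarrow> (nat \<Rightarrow> 'a \<Rightarrow> real) \<Rightarrow> nat \<Rightarrow> real" where
  "max_cost A c i = Max (c i ` A)"

text \<open>The third conjunct says that the zero vector is not of the form \<open>c(x)\<close> for a lottery \<open>x\<close>.
  The third and fourth conjuncts rule out \<open>n = 0\<close> with nonempty \<open>A\<close> and \<open>n \<ge> 1\<close> with empty \<open>A\<close>,
  respectively; if \<open>n = 0\<close> and \<open>A\<close> is empty, then there are no lotteries.\<close>

definition public_bads_instance :: "nat \<Rightarrow> 'a set \<Rightarrow> (nat \<Rightarrow> 'a \<Rightarrow> real) \<Rightarrow> bool" where
  "public_bads_instance n A c \<longleftrightarrow>
     finite A \<and>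
     (\<forall>i\<in>{1..n}. \<forall>a\<in>A. 0 \<le> c i a) \<and>
     \<not> (\<exists>x\<in>lotteries A. \<forall>i\<in>{1..n}. lin_ext A (c i) x = 0) \<and>
     (\<forall>i\<in>{1..n}. \<exists>a\<in>A. c i a < max_cost A c i)"

definition dual_valuation :: "'a set \<Rightarrow> (nat \<Rightarrow> 'a \<Rightarrow> real) \<Rightarrow> nat \<Rightarrow> 'a \<Rightarrow> real" where
  "dual_valuation A c i a = max_cost A c i - c i a"

definition flipped_MNW :: "nat \<Rightarrow> 'a set \<Rightarrow> (nat \<Rightarrow> 'a \<Rightarrow> real) \<Rightarrow> ('a \<Rightarrow> real) set" where
  "flipped_MNW n A c =
     {x. is_arg_max (\<lambda>x. \<Prod>i\<in>{1..n}. lin_ext A (dual_valuation A c i) x)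
           (\<lambda>x. x \<in> lotteries A) x}"

definition completion_core :: "nat \<Rightarrow> 'a set \<Rightarrow> (nat \<Rightarrow> 'a \<Rightarrow> real) \<Rightarrow> ('a \<Rightarrow> real) set" where
  "completion_core n A c =
     {x \<in> lotteries A.
        \<not> (\<exists>S y. S \<subseteq> {1..n} \<and> y \<in> lotteries A \<and>
              (\<forall>i\<in>S. real (card S) / real n * lin_ext A (c i) y
                     + (real n - real (card S)) / real n * max_cost A c i
                     \<le> lin_ext A (c i) x) \<and>
              (\<exists>i\<in>S. real (card S) / real n * lin_ext A (c i) y
                     + (real n - real (card S)) / real n * max_cost A c i
                     < lin_ext A (c i) x))}"

end

theory Submission
  imports Defs
begin

text \<open>
  In terms of the dual valuations, a blocking coalition \<open>S\<close> with lottery \<open>y\<close> satisfies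
  \<open>v\<^sub>i(x) \<le> (|S|/n) v\<^sub>i(y)\<close> for all \<open>i \<in> S\<close>, once strictly.  Since the Nash optimum \<open>x\<close> gives every
  agent a positive value, summing the ratios over \<open>S\<close> yields \<open>\<Sum>\<^sub>i v\<^sub>i(y) / v\<^sub>i(x) > n\<close>.
  But then the Nash product increases when moving from \<open>x\<close> a little towards \<open>y\<close>.
\<close>

lemma lin_ext_convex_combination:
  "lin_ext A f (\<lambda>a. (1 - t) * x a + t * y a) = (1 - t) * lin_ext A f x + t * lin_ext A f y"
  by (simp add: lin_ext_def sum_distrib_left sum.distrib [symmetric] algebra_simps)

lemma lotteries_convex_combination:
  assumes "x \<in> lotteries A" "y \<in> lotteries A" "0 \<le> t" "t \<le> 1"
  shows "(\<lambda>a. (1 - t) * x a + t * y a) \<in> lotteries A"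
  using assms
  by (simp add: lotteries_def sum.distrib sum_distrib_left [symmetric])

lemma lin_ext_dual_valuation:
  assumes "x \<in> lotteries A"
  shows "lin_ext A (dual_valuation A c i) x = max_cost A c i - lin_ext A (c i) x"
  using assms
  by (simp add: lin_ext_def dual_valuation_def lotteries_def right_diff_distrib
      sum_subtractf sum_distrib_right [symmetric])

lemma dual_valuation_nonneg:
  assumes "finite A" "a \<in> A"
  shows "0 \<le> dual_valuation A c i a"
  using assms by (simp add: dual_valuation_def max_cost_def)

lemma lin_ext_dual_valuation_nonneg:
  assumes "finite A" "x \<in> lotteries A"
  shows "0 \<le> lin_ext A (dual_valuation A c i) x"
  using assms unfolding lin_ext_def lotteries_def
  by (auto intro!: sum_nonneg mult_nonneg_nonneg dual_valuation_nonneg)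

text \<open>The uniform lottery works: its full support includes, for each agent in
  \<open>I\<close>, a bad of positive dual value, and no bad has a negative one.\<close>

lemma exists_lottery_with_positive_valuations:
  assumes "finite A" "A \<noteq> {}" "\<And>i. i \<in> I \<Longrightarrow> \<exists>a\<in>A. c i a < max_cost A c i"
  shows "\<exists>u\<in>lotteries A. \<forall>i\<in>I. 0 < lin_ext A (dual_valuation A c i) u"
proof
  define u where "u = (\<lambda>a. if a \<in> A then 1 / real (card A) else 0)"
  have card: "0 < real (card A)"
    using assms by (simp add: card_gt_0_iff)
  show "u \<in> lotteries A"
    using card by (simp add: lotteries_def u_def)
  show "\<forall>i\<in>I. 0 < lin_ext A (dual_valuation A c i) u"
  proof
    fix i assume "i \<in> I"
    then obtain a where a: "a \<in> A" "c i a < max_cost A c i"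
      using assms(3) by blast
    show "0 < lin_ext A (dual_valuation A c i) u"
      unfolding lin_ext_def
    proof (rule sum_pos2)
      show "0 < u a * dual_valuation A c i a"
        using a card by (simp add: u_def dual_valuation_def)
    qed (use assms(1) a card in \<open>auto simp: u_def dual_valuation_nonneg\<close>)
  qed
qed

text \<open>At \<open>t = 0\<close> the product equals 1 and its derivative is the sum of the
  \<open>d i\<close>, so a positive sum makes it increase just to the right of 0.\<close>

lemma prod_one_plus_exceeds_one:
  fixes d :: "'i \<Rightarrow> real"
  assumes "0 < (\<Sum>i\<in>I. d i)"
  shows "\<exists>t. 0 < t \<and> t < 1 \<and> 1 < (\<Prod>i\<in>I. 1 + t * d i)"
proof -
  have "((\<lambda>t. \<Prod>i\<in>I. 1 + t * d i) has_field_derivative (\<Sum>i\<in>I. d i)) (at 0)"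
    by (rule has_field_derivative_prod [where f = "\<lambda>i t. 1 + t * d i" and f' = d and z = 0, simplified])
      (auto intro!: derivative_eq_intros)
  from DERIV_pos_inc_right [OF this assms] obtain \<delta>
    where "0 < \<delta>" and \<delta>: "\<And>h. 0 < h \<Longrightarrow> h < \<delta> \<Longrightarrow> 1 < (\<Prod>i\<in>I. 1 + h * d i)"
    by auto
  from \<open>0 < \<delta>\<close> have "0 < min \<delta> 1 / 2" "min \<delta> 1 / 2 < \<delta>" "min \<delta> 1 / 2 < 1"
    by auto
  with \<delta> show ?thesis by blast
qed

text \<open>A single zero factor would make the Nash product vanish, whereas some lottery attains a
  positive product. This makes division by the optimal values legitimate.\<close>

lemma flipped_MNW_positive:
  assumes inst: "public_bads_instance n A c" and x: "x \<in> flipped_MNW n A c"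
    and i: "i \<in> {1..n}"
  shows "0 < lin_ext A (dual_valuation A c i) x"
proof -
  let ?v = "\<lambda>i. lin_ext A (dual_valuation A c i)"
  have fin: "finite A" and nonconst: "\<And>i. i \<in> {1..n} \<Longrightarrow> \<exists>a\<in>A. c i a < max_cost A c i"
    using inst by (auto simp: public_bads_instance_def)
  have "A \<noteq> {}"
    using nonconst [OF i] by blast
  then obtain u where u: "u \<in> lotteries A" "\<forall>j\<in>{1..n}. 0 < ?v j u"
    using exists_lottery_with_positive_valuations [OF fin _ nonconst] by blast
  have "0 < (\<Prod>j\<in>{1..n}. ?v j u)"
    using u(2) by (intro prod_pos) auto
  also have "\<dots> \<le> (\<Prod>j\<in>{1..n}. ?v j x)"
    using x u(1) by (auto simp: flipped_MNW_def is_arg_max_def not_less)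
  finally have "?v i x \<noteq> 0"
    using i by (metis finite_atLeastAtMost less_irrefl prod_zero)
  moreover have "0 \<le> ?v i x"
    using x fin by (intro lin_ext_dual_valuation_nonneg) (auto simp: flipped_MNW_def is_arg_max_def)
  ultimately show ?thesis by simp
qed

text \<open>This is the first-order optimality condition for Nash welfare: the directional
  derivative of the log-product at \<open>x\<close> towards \<open>y\<close> is the sum of the
  ratios minus \<open>n\<close>.\<close>

lemma flipped_MNW_sum_ratios_le:
  assumes inst: "public_bads_instance n A c" and x: "x \<in> flipped_MNW n A c"
    and y: "y \<in> lotteries A"
  shows "(\<Sum>i\<in>{1..n}. lin_ext A (dual_valuation A c i) y / lin_ext A (dual_valuation A c i) x)
           \<le> real n"
proof (rule ccontr)
  let ?v = "\<lambda>i. lin_ext A (dual_valuation A c i)"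
  \<comment> \<open>\<open>d i\<close> is the relative gain of agent \<open>i\<close> in passing
    from \<open>x\<close> to \<open>y\<close>. By linearity, moving a fraction \<open>t\<close> of
    the way multiplies the value of \<open>i\<close> by \<open>1 + t * d i\<close>.\<close>
  define d where "d i = ?v i y / ?v i x - 1" for i
  assume "\<not> ?thesis"
  then have "0 < (\<Sum>i\<in>{1..n}. d i)"
    by (simp add: d_def sum_subtractf)
  then obtain t where t: "0 < t" "t < 1" "1 < (\<Prod>i\<in>{1..n}. 1 + t * d i)"
    using prod_one_plus_exceeds_one by blast
  define z where "z = (\<lambda>a. (1 - t) * x a + t * y a)"
  have pos: "0 < ?v i x" if "i \<in> {1..n}" for i
    using flipped_MNW_positive [OF inst x that] .
  have "(\<Prod>i\<in>{1..n}. ?v i z) = (\<Prod>i\<in>{1..n}. ?v i x * (1 + t * d i))"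
    unfolding z_def lin_ext_convex_combination
    by (rule prod.cong [OF refl], drule pos) (simp add: d_def field_simps)
  also have "\<dots> = (\<Prod>i\<in>{1..n}. ?v i x) * (\<Prod>i\<in>{1..n}. 1 + t * d i)"
    by (rule prod.distrib)
  also have "(\<Prod>i\<in>{1..n}. ?v i x) < \<dots>"
    using mult_strict_left_mono [OF t(3) prod_pos [of "{1..n}" "\<lambda>i. ?v i x", OF pos]] by simp
  finally have "(\<Prod>i\<in>{1..n}. ?v i x) < (\<Prod>i\<in>{1..n}. ?v i z)" .
  moreover have "z \<in> lotteries A"
    unfolding z_def using x y t
    by (intro lotteries_convex_combination) (auto simp: flipped_MNW_def is_arg_max_def)
  ultimately show False
    using x by (auto simp: flipped_MNW_def is_arg_max_def)
qed

theorem theorem5p7: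
  fixes n :: nat and A :: "'a set" and c :: "nat \<Rightarrow> 'a \<Rightarrow> real" and x :: "'a \<Rightarrow> real"
  assumes "public_bads_instance n A c"
    and "x \<in> flipped_MNW n A c"
  shows "x \<in> completion_core n A c"
proof (rule ccontr)
  let ?v = "\<lambda>i. lin_ext A (dual_valuation A c i)"
  let ?block = "\<lambda>S y i. real (card S) / real n * lin_ext A (c i) y
                  + (real n - real (card S)) / real n * max_cost A c i"
  have xl: "x \<in> lotteries A"
    using assms(2) by (simp add: flipped_MNW_def is_arg_max_def)
  assume "x \<notin> completion_core n A c"
  then obtain S y k where S: "S \<subseteq> {1..n}" and y: "y \<in> lotteries A"
    and le: "\<And>i. i \<in> S \<Longrightarrow> ?block S y i \<le> lin_ext A (c i) x"
    and k: "k \<in> S" "?block S y k < lin_ext A (c k) x"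
    using xl by (auto simp: completion_core_def)
  have finS: "finite S"
    using S finite_subset by blast
  have n: "0 < real n" and s: "0 < real (card S)"
    using S k(1) finS by (auto simp: card_gt_0_iff)
  have pos: "0 < ?v i x" if "i \<in> S" for i
    using flipped_MNW_positive [OF assms] that S by blast
  \<comment> \<open>The completion charges the maximal cost, of dual value zero, with weight
    \<open>1 - |S|/n\<close>; only the share \<open>|S|/n\<close> of \<open>y\<close> yields dual
    value.\<close>
  have dual: "lin_ext A (c i) x - ?block S y i = real (card S) / real n * ?v i y - ?v i x" for i
    using n by (simp add: lin_ext_dual_valuation xl y field_simps)
  have ratio: "real n / real (card S) \<le> ?v i y / ?v i x" if "i \<in> S" for i
    using le [OF that] dual [of i] pos [OF that] n s by (simp add: field_simps)
  have ratio_less: "real n / real (card S) < ?v k y / ?v k x"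
    using k(2) dual [of k] pos [OF k(1)] n s by (simp add: field_simps)
  \<comment> \<open>Each member of \<open>S\<close> has ratio at least \<open>n/|S|\<close>, and
    \<open>k\<close> exceeds it, so \<open>S\<close> alone pushes the sum above
    \<open>n\<close>.\<close>
  have "real n = (\<Sum>i\<in>S. real n / real (card S))"
    using s by simp
  also have "\<dots> < (\<Sum>i\<in>S. ?v i y / ?v i x)"
    using ratio ratio_less k(1) finS by (intro sum_strict_mono_ex1) auto
  \<comment> \<open>Agents outside \<open>S\<close> contribute nonnegative ratios.\<close>
  also have "\<dots> \<le> (\<Sum>i\<in>{1..n}. ?v i y / ?v i x)"
    using S assms xl y
    by (intro sum_mono2 divide_nonneg_nonneg lin_ext_dual_valuation_nonneg)
      (auto simp: public_bads_instance_def)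
  also have "\<dots> \<le> real n"
    by (rule flipped_MNW_sum_ratios_le [OF assms y])
  finally show False by simp
qed

end
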